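(* Let $n\ge 3$ and let $z_1,\dots,z_{n-1}$ be pairwise distinct complex numbers. For each $j$ with $2\le j\le n-1$ define numbers $a_{1,j},\dots,a_{n-1,j}$ by $a_{j-1,j}=1$, $a_{n-1,j}=-1$, and $a_{k,j}=0$ for all other $k$. Put $$m_j=\sum_{i=1}^{n-1}a_{i,j}z_i,\qquad b_{k,j}=a_{k,j}\sum_{i\ne k}z_i+\frac{m_j}{n-1}\quad(1\le k\le n-1),$$ $$G_{n-2,j}=\mathrm{col}[0,a_{1,j},\dots,a_{n-1,j}],\qquad G_{n-1,j}=\frac{m_j}{n(n-1)}V_3+\mathrm{col}[0,b_{1,j},\dots,b_{n-1,j}],$$ where $V_3=\mathrm{col}[n-1,-1,\dots,-1]\in\mathbb{C}^n$, and $$\ell_{k,j}=A_{n-2,k}\,G_{n-2,j}+A_{n-1,k}\,G_{n-1,j}\qquad(1\le k\le n-1).$$ Then the vector functions $$Y_j(z)=\sum_{k=1}^{n-1}\frac{\ell_{k,j}}{z-z_k},\qquad 2\le j\le n-1,$$ are linearly independent rational solutions of the system $$\frac{dY}{dz}=\rho\sum_{k=1}^{n-1}\frac{P_k}{z-z_k}\,Y\qquad\text{with }\rho=-1 .$$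
   Context: For $1\le k\le n-1$, $P_k=P(1,k+1)$ denotes the $n\times n$ permutation matrix of the transposition of $1$ and $k+1$ in the natural representation of the symmetric group $S_n$: its $(1,k+1)$ and $(k+1,1)$ entries equal $1$, its $(l,l)$ entries equal $1$ for $l\ne 1,k+1$, and all other entries are $0$. $\mathrm{col}[\cdot]$ denotes a column vector. $M_1$ is the $(n-1)\times(n-1)$ Vandermonde matrix with entries $(M_1)_{p,k}=z_k^{p-1}$ ($1\le p,k\le n-1$), and $A_{p,k}$ denotes the (signed) cofactor of the entry $(M_1)_{p,k}$, i.e. $(-1)^{p+k}$ times the determinant of $M_1$ with row $p$ and column $k$ deleted. Explicitly, $A_{n-1,k}=(-1)^{n-1+k}\prod_{i>j;\ i,j\ne k}(z_i-z_j)$ and $A_{n-2,k}=-A_{n-1,k}\sum_{i\ne k}z_i$, where indices range over $1,\dots,n-1$. Sums $\sum_{i\neq k}$ are over $1\le i\le n-1$, $i\ne k$. *)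

theory Defs
  imports
    Complex_Main
    "HOL-Computational_Algebra.Polynomial"
    "Jordan_Normal_Form.Determinant"
begin

text \<open>
  Matrices and vectors of size \<open>n\<close> are indexed by \<open>0, \<dots>, n - 1\<close>, so row \<open>i\<close> of the usual
  notation is index \<open>i - 1\<close> here. The scalars \<open>z\<^sub>k\<close>, \<open>a\<^sub>k\<^sub>j\<close>, \<open>b\<^sub>k\<^sub>j\<close> and the index \<open>k\<close> of \<open>P\<^sub>k\<close>
  keep their range \<open>1, \<dots>, n - 1\<close>. The variable of the vector functions is called \<open>w\<close>.
\<close>

definition poles :: "nat \<Rightarrow> (nat \<Rightarrow> complex) \<Rightarrow> complex set" where
  "poles n z = z ` {1..n-1}"

definition swap_mat :: "nat \<Rightarrow> nat \<Rightarrow> complex mat" where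
  "swap_mat n k = mat n n (\<lambda>(r, s).
     if (r = 0 \<and> s = k) \<or> (r = k \<and> s = 0) \<or> (r = s \<and> r \<noteq> 0 \<and> r \<noteq> k) then 1 else 0)"


subsection \<open>The system \<open>dY/dw = \<rho> \<Sum>\<^sub>k P\<^sub>k / (w - z\<^sub>k) Y\<close>\<close>

text \<open>Sums of vectors and matrices are taken in the library's structures of the fixed size \<open>n\<close>.\<close>

definition system_mat :: "nat \<Rightarrow> (nat \<Rightarrow> complex) \<Rightarrow> complex \<Rightarrow> complex mat" where
  "system_mat n z w =
     finsum (module_mat TYPE(complex) n n)
       (\<lambda>k. (1 / (w - z k)) \<cdot>\<^sub>m swap_mat n k) {1..n-1}"

definition has_vec_derivative ::
  "nat \<Rightarrow> (complex \<Rightarrow> complex vec) \<Rightarrow> complex vec \<Rightarrow> complex \<Rightarrow> bool" where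
  "has_vec_derivative n Y Y' w \<longleftrightarrow>
     Y w \<in> carrier_vec n \<and> Y' \<in> carrier_vec n \<and>
     (\<forall>i<n. ((\<lambda>u. Y u $ i) has_field_derivative Y' $ i) (at w))"

definition is_solution ::
  "nat \<Rightarrow> complex \<Rightarrow> (nat \<Rightarrow> complex) \<Rightarrow> (complex \<Rightarrow> complex vec) \<Rightarrow> bool" where
  "is_solution n \<rho> z Y \<longleftrightarrow>
     (\<forall>w \<in> - poles n z. has_vec_derivative n Y (\<rho> \<cdot>\<^sub>v (system_mat n z w *\<^sub>v Y w)) w)"

definition rational_vec_on :: "nat \<Rightarrow> complex set \<Rightarrow> (complex \<Rightarrow> complex vec) \<Rightarrow> bool" where
  "rational_vec_on n D Y \<longleftrightarrow>
     (\<forall>w \<in> D. Y w \<in> carrier_vec n) \<and>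
     (\<forall>i<n. \<exists>p q. q \<noteq> 0 \<and> (\<forall>w \<in> D. poly q w \<noteq> 0 \<and> Y w $ i = poly p w / poly q w))"

text \<open>
  Linear independence over the complex numbers, as functions on \<open>D\<close>, of a finite family; being
  a statement about the indexed family it also excludes repetitions.
\<close>

definition lin_indep_on ::
  "nat \<Rightarrow> complex set \<Rightarrow> nat set \<Rightarrow> (nat \<Rightarrow> complex \<Rightarrow> complex vec) \<Rightarrow> bool" where
  "lin_indep_on n D J Y \<longleftrightarrow>
     (\<forall>c. (\<forall>w \<in> D. finsum_vec TYPE(complex) n (\<lambda>j. c j \<cdot>\<^sub>v Y j w) J = 0\<^sub>v n)
        \<longrightarrow> (\<forall>j \<in> J. c j = 0))"


subsection \<open>The functions \<open>Y\<^sub>j\<close>\<close>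

definition vandermonde_mat :: "nat \<Rightarrow> (nat \<Rightarrow> complex) \<Rightarrow> complex mat" where
  "vandermonde_mat n z = mat (n-1) (n-1) (\<lambda>(p, k). z (k+1) ^ p)"

text \<open>\<open>A\<^sub>p\<^sub>k\<close>; shifting both indices by one does not change the sign \<open>(-1)\<^sup>p\<^sup>+\<^sup>k\<close>.\<close>

definition A_cof :: "nat \<Rightarrow> (nat \<Rightarrow> complex) \<Rightarrow> nat \<Rightarrow> nat \<Rightarrow> complex" where
  "A_cof n z p k = cofactor (vandermonde_mat n z) (p-1) (k-1)"

definition a_coef :: "nat \<Rightarrow> nat \<Rightarrow> nat \<Rightarrow> complex" where
  "a_coef n k j = (if k = j - 1 then 1 else if k = n - 1 then -1 else 0)"

definition m_coef :: "nat \<Rightarrow> (nat \<Rightarrow> complex) \<Rightarrow> nat \<Rightarrow> complex" where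
  "m_coef n z j = (\<Sum>i\<in>{1..n-1}. a_coef n i j * z i)"

definition b_coef :: "nat \<Rightarrow> (nat \<Rightarrow> complex) \<Rightarrow> nat \<Rightarrow> nat \<Rightarrow> complex" where
  "b_coef n z k j =
     a_coef n k j * (\<Sum>i\<in>{1..n-1} - {k}. z i) + m_coef n z j / of_nat (n - 1)"

definition V3 :: "nat \<Rightarrow> complex vec" where
  "V3 n = vec n (\<lambda>i. if i = 0 then of_nat (n - 1) else -1)"

text \<open>\<open>G_pen\<close> and \<open>G_last\<close> are \<open>G\<^sub>n\<^sub>-\<^sub>2\<^sub>,\<^sub>j\<close> and \<open>G\<^sub>n\<^sub>-\<^sub>1\<^sub>,\<^sub>j\<close>.\<close>

definition G_pen :: "nat \<Rightarrow> nat \<Rightarrow> complex vec" where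
  "G_pen n j = vec n (\<lambda>i. if i = 0 then 0 else a_coef n i j)"

definition G_last :: "nat \<Rightarrow> (nat \<Rightarrow> complex) \<Rightarrow> nat \<Rightarrow> complex vec" where
  "G_last n z j =
     (m_coef n z j / (of_nat n * of_nat (n - 1))) \<cdot>\<^sub>v V3 n
     + vec n (\<lambda>i. if i = 0 then 0 else b_coef n z i j)"

definition ell :: "nat \<Rightarrow> (nat \<Rightarrow> complex) \<Rightarrow> nat \<Rightarrow> nat \<Rightarrow> complex vec" where
  "ell n z k j =
     A_cof n z (n-2) k \<cdot>\<^sub>v G_pen n j + A_cof n z (n-1) k \<cdot>\<^sub>v G_last n z j"

definition Y_fun :: "nat \<Rightarrow> (nat \<Rightarrow> complex) \<Rightarrow> nat \<Rightarrow> complex \<Rightarrow> complex vec" where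
  "Y_fun n z j w =
     finsum_vec TYPE(complex) n (\<lambda>k. (1 / (w - z k)) \<cdot>\<^sub>v ell n z k j) {1..n-1}"

end

theory Submission
  imports Defs
begin

text \<open>
  The polynomial \<open>L\<^sub>k(x) = \<Sum>\<^sub>p A\<^sub>p\<^sub>k x\<^sup>p\<^sup>-\<^sup>1\<close> takes the value \<open>\<Delta> = det M\<^sub>1\<close> at \<open>z\<^sub>k\<close> and vanishes at
  the other nodes, so \<open>L\<^sub>k(x) = D\<^sub>k \<Prod>\<^sub>i\<^sub>\<noteq>\<^sub>k (x - z\<^sub>i)\<close> with \<open>D\<^sub>k = A\<^sub>n\<^sub>-\<^sub>1\<^sub>,\<^sub>k\<close>, whereas
  \<open>\<Sum>\<^sub>k L\<^sub>k\<close> is the constant \<open>\<Delta>\<close>. Comparing coefficients gives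
  \<open>A\<^sub>n\<^sub>-\<^sub>2\<^sub>,\<^sub>k = - D\<^sub>k \<Sum>\<^sub>i\<^sub>\<noteq>\<^sub>k z\<^sub>i\<close>, \<open>\<Sum>\<^sub>k D\<^sub>k = 0\<close> and
  \<open>\<Sum>\<^sub>k D\<^sub>k / (w - z\<^sub>k) = \<Delta> / \<Prod>\<^sub>k (w - z\<^sub>k)\<close>. Hence \<open>Y\<^sub>j = \<Delta> / \<Prod>\<^sub>k (w - z\<^sub>k) \<cdot> u\<close>, where \<open>u\<close>
  has the entry \<open>m\<^sub>j/n\<close> at the top and \<open>m\<^sub>j/n + a\<^sub>i\<^sub>j (w - z\<^sub>i)\<close> below. Since the logarithmic
  derivative of the scalar factor is \<open>- \<Sum>\<^sub>k 1 / (w - z\<^sub>k)\<close>, the system becomes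
  \<open>u' = \<Sum>\<^sub>k (1 - P\<^sub>k) u / (w - z\<^sub>k)\<close>, which is immediate from \<open>\<Sum>\<^sub>i a\<^sub>i\<^sub>j = 0\<close>.
\<close>

section \<open>Products of linear factors: coefficients and logarithmic derivative\<close>

lemma degree_prod_linear:
  fixes z :: "'b \<Rightarrow> 'a :: idom"
  shows "degree (\<Prod>i\<in>A. [:- z i, 1:]) = card A"
  by (subst degree_prod_sum_eq) auto

lemma coeff_prod_linear_card:
  fixes z :: "'b \<Rightarrow> 'a :: idom"
  shows "coeff (\<Prod>i\<in>A. [:- z i, 1:]) (card A) = 1"
  using lead_coeff_prod[of "\<lambda>i. [:- z i, 1:]" A] by (simp add: degree_prod_linear)

lemma coeff_prod_linear_subleading:
  fixes z :: "'b \<Rightarrow> 'a :: idom"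
  assumes "finite A" "card A = Suc m"
  shows "coeff (\<Prod>i\<in>A. [:- z i, 1:]) m = - (\<Sum>i\<in>A. z i)"
  using assms
proof (induction A arbitrary: m rule: finite_induct)
  case (insert x A)
  then have m: "m = card A" by simp
  show ?case
  proof (cases m)
    case 0
    with insert.hyps m have "A = {}" by simp
    with 0 show ?thesis by simp
  next
    case (Suc m')
    with insert.IH m have "coeff (\<Prod>i\<in>A. [:- z i, 1:]) m' = - (\<Sum>i\<in>A. z i)" by simp
    with insert.hyps Suc m coeff_prod_linear_card[of z A] show ?thesis
      by (simp add: mult_pCons_left)
  qed
qed simp

lemma has_field_derivative_inverse_prod_linear:
  fixes z :: "'b \<Rightarrow> 'a :: real_normed_field"
  assumes "finite K" "\<And>k. k \<in> K \<Longrightarrow> w \<noteq> z k"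
  shows "((\<lambda>u. 1 / (\<Prod>k\<in>K. u - z k)) has_field_derivative
           - (\<Sum>k\<in>K. 1 / (w - z k)) / (\<Prod>k\<in>K. w - z k)) (at w)"
  using assms
proof (induction K rule: finite_induct)
  case (insert x K)
  define P S where "P = (\<Prod>k\<in>K. w - z k)" and "S = (\<Sum>k\<in>K. 1 / (w - z k))"
  have nz: "w - z x \<noteq> 0" "P \<noteq> 0" using insert by (auto simp: P_def)
  \<comment> \<open>Product rule after splitting off one factor: it adds
    \<open>1 / (w - z x)\<close> to the logarithmic derivative.\<close>
  have "((\<lambda>u. (1 / (u - z x)) * (1 / (\<Prod>k\<in>K. u - z k))) has_field_derivative
      (- 1 / (w - z x)\<^sup>2) * (1 / P) + (- S / P) * (1 / (w - z x))) (at w)"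
    using nz insert.IH insert.prems unfolding P_def S_def
    by (intro DERIV_mult) (auto intro!: derivative_eq_intros simp: power2_eq_square)
  moreover have "(- 1 / a\<^sup>2) * (1 / P) + (- S / P) * (1 / a) = - (1 / a + S) / (a * P)"
    if "a \<noteq> 0" for a
    using that nz(2) by (simp add: field_simps power2_eq_square)
  ultimately show ?case using insert.hyps nz(1) by (simp add: P_def S_def)
qed auto

section \<open>Entrywise form of the system\<close>

lemma index_finsum_mat:
  assumes "finite F" "r < nr" "s < nc" "M \<in> F \<rightarrow> carrier_mat nr nc"
  shows "finsum (module_mat TYPE('a :: comm_ring_1) nr nc) M F $$ (r, s) = (\<Sum>k\<in>F. M k $$ (r, s))"
    and "finsum (module_mat TYPE('a) nr nc) M F \<in> carrier_mat nr nc"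
proof -
  interpret abelian_group "module_mat TYPE('a) nr nc" by (rule abelian_group_mat)
  have car: "finsum (module_mat TYPE('a) nr nc) M G \<in> carrier_mat nr nc"
    if "M \<in> G \<rightarrow> carrier_mat nr nc" for G
    using finsum_closed[of M G] that by (simp add: module_mat_simps)
  show "finsum (module_mat TYPE('a) nr nc) M F \<in> carrier_mat nr nc" using assms(4) by (rule car)
  show "finsum (module_mat TYPE('a) nr nc) M F $$ (r, s) = (\<Sum>k\<in>F. M k $$ (r, s))"
    using assms(1,4)
  proof (induction F rule: finite_induct)
    case empty
    then show ?case using assms by (simp add: module_mat_simps)
  next
    case (insert x F)
    then have "M \<in> F \<rightarrow> carrier_mat nr nc" "M x \<in> carrier_mat nr nc" by auto
    with insert show ?case using assms(2,3) car[of F]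
      by (simp add: finsum_insert module_mat_simps)
  qed
qed

text \<open>A row of a permutation matrix has a single 1; in row \<open>r\<close> it sits in the
  column to which the transposition of \<open>0\<close> and \<open>k\<close> sends
  \<open>r\<close>.\<close>

lemma index_swap_mat_mult:
  assumes "r < n" "1 \<le> k" "k < n"
  shows "(\<Sum>s<n. swap_mat n k $$ (r, s) * y s) = y (if r = 0 then k else if r = k then 0 else r)"
    (is "_ = y ?t")
proof -
  have "(\<Sum>s<n. swap_mat n k $$ (r, s) * y s) = (\<Sum>s<n. if s = ?t then y s else 0)"
    using assms by (intro sum.cong) (auto simp: swap_mat_def)
  also have "\<dots> = y ?t" using assms by simp
  finally show ?thesis .
qed

text \<open>Reduces the system to scalar equations: row 0 involves all lower entries, whereas in a
  row \<open>r \<noteq> 0\<close> only the summand \<open>k = r\<close> reads the top entry instead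
  of entry \<open>r\<close>.\<close>

lemma system_mat_mult_index:
  assumes "r < n" "y \<in> carrier_vec n"
  shows "(system_mat n z w *\<^sub>v y) $ r
    = (\<Sum>k\<in>{1..n-1}. y $ (if r = 0 then k else if r = k then 0 else r) / (w - z k))"
proof -
  have car: "(\<lambda>k. (1 / (w - z k)) \<cdot>\<^sub>m swap_mat n k) \<in> {1..n-1} \<rightarrow> carrier_mat n n"
    by (auto simp: swap_mat_def)
  have dim: "system_mat n z w \<in> carrier_mat n n"
    unfolding system_mat_def by (rule index_finsum_mat(2)[OF _ assms(1) assms(1) car]) simp
  have idx: "system_mat n z w $$ (r, s) = (\<Sum>k\<in>{1..n-1}. swap_mat n k $$ (r, s) / (w - z k))"
    if "s < n" for s
    unfolding system_mat_def
    by (subst index_finsum_mat(1)[OF _ assms(1) that car])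
       (use assms that in \<open>auto intro!: sum.cong simp: swap_mat_def\<close>)
  have "(system_mat n z w *\<^sub>v y) $ r = (\<Sum>s<n. system_mat n z w $$ (r, s) * y $ s)"
    using dim assms by (simp add: scalar_prod_def atLeast0LessThan)
  also have "\<dots> = (\<Sum>s<n. \<Sum>k\<in>{1..n-1}. swap_mat n k $$ (r, s) * y $ s / (w - z k))"
    by (intro sum.cong) (auto simp: idx sum_distrib_right)
  also have "\<dots> = (\<Sum>k\<in>{1..n-1}. (\<Sum>s<n. swap_mat n k $$ (r, s) * y $ s) / (w - z k))"
    by (subst sum.swap) (simp add: sum_divide_distrib)
  also have "\<dots> = (\<Sum>k\<in>{1..n-1}. y $ (if r = 0 then k else if r = k then 0 else r) / (w - z k))"
    using assms by (intro sum.cong arg_cong2[where f = "(/)"] refl index_swap_mat_mult) auto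
  finally show ?thesis .
qed


subsection \<open>Cofactors of the Vandermonde matrix\<close>

text \<open>For distinct nodes this is the Lagrange basis polynomial of the node \<open>z k\<close>,
  scaled by the determinant. \<open>Suc p\<close> appears because \<open>A_cof\<close> counts rows
  from 1 and powers start at 0.\<close>

definition cofactor_poly :: "nat \<Rightarrow> (nat \<Rightarrow> complex) \<Rightarrow> nat \<Rightarrow> complex poly" where
  "cofactor_poly n z k = (\<Sum>p<n-1. monom (A_cof n z (Suc p) k) p)"

lemma coeff_cofactor_poly:
  "coeff (cofactor_poly n z k) p = (if p < n - 1 then A_cof n z (Suc p) k else 0)"
proof -
  have "coeff (cofactor_poly n z k) p = (\<Sum>q<n-1. if q = p then A_cof n z (Suc q) k else 0)"
    unfolding cofactor_poly_def coeff_sum by (intro sum.cong) auto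
  then show ?thesis by simp
qed

text \<open>Evaluating at \<open>z i\<close> pairs row \<open>k\<close> of the adjugate with column
  \<open>i\<close> of the Vandermonde matrix, so this is an entry of \<open>adj_mat M * M\<close>, a
  scalar matrix.\<close>

lemma poly_cofactor_poly:
  assumes "k \<in> {1..n-1}" "i \<in> {1..n-1}"
  shows "poly (cofactor_poly n z k) (z i) = (if i = k then det (vandermonde_mat n z) else 0)"
proof -
  define M where "M = vandermonde_mat n z"
  have M: "M \<in> carrier_mat (n-1) (n-1)" by (simp add: M_def vandermonde_mat_def)
  have ik: "i - 1 < n - 1" "k - 1 < n - 1" "i - 1 = k - 1 \<longleftrightarrow> i = k" using assms by auto
  have "poly (cofactor_poly n z k) (z i) = (\<Sum>p<n-1. A_cof n z (Suc p) k * z i ^ p)"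
    by (simp add: cofactor_poly_def poly_sum poly_monom)
  also have "\<dots> = (\<Sum>p<n-1. adj_mat M $$ (k-1, p) * M $$ (p, i-1))"
    using M ik assms
    by (intro sum.cong) (auto simp: A_cof_def adj_mat_def M_def vandermonde_mat_def)
  also have "\<dots> = (adj_mat M * M) $$ (k-1, i-1)"
    using M ik adj_mat(1)[OF M] by (simp add: scalar_prod_def atLeast0LessThan)
  also have "\<dots> = (if i = k then det M else 0)"
    unfolding adj_mat(3)[OF M] using ik by auto
  finally show ?thesis by (simp add: M_def)
qed

text \<open>A kernel vector of the transpose is the coefficient list of a polynomial vanishing at
  all \<open>n-1\<close> distinct nodes; its degree is too small for that unless it is zero.\<close>

lemma det_vandermonde_nonzero:
  assumes "inj_on z {1..n-1}"
  shows "det (vandermonde_mat n z) \<noteq> 0"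
proof
  define M where "M = vandermonde_mat n z"
  have M: "M \<in> carrier_mat (n-1) (n-1)" by (simp add: M_def vandermonde_mat_def)
  assume "det (vandermonde_mat n z) = 0"
  then have "det (transpose_mat M) = 0" using det_transpose[OF M] by (simp add: M_def)
  then obtain v where v: "v \<in> carrier_vec (n-1)" "v \<noteq> 0\<^sub>v (n-1)"
    "transpose_mat M *\<^sub>v v = 0\<^sub>v (n-1)"
    using det_0_iff_vec_prod_zero_field[of "transpose_mat M" "n-1"] M by auto
  define q where "q = (\<Sum>p<n-1. monom (v $ p) p)"
  have coeff_q: "coeff q p = (if p < n-1 then v $ p else 0)" for p
    by (simp add: q_def coeff_sum)
  have root: "poly q (z i) = 0" if "i \<in> {1..n-1}" for i
  proof -
    have "i - 1 < n - 1" using that by auto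
    have "poly q (z i) = (transpose_mat M *\<^sub>v v) $ (i-1)"
      using that v(1) M \<open>i - 1 < n - 1\<close>
      by (auto simp: q_def poly_sum poly_monom scalar_prod_def M_def vandermonde_mat_def
            atLeast0LessThan mult.commute intro!: sum.cong)
    also have "\<dots> = 0" using v(3) that by auto
    finally show ?thesis .
  qed
  obtain p where p: "p < n-1" "v $ p \<noteq> 0" using v(1,2) by (metis carrier_vecD eq_vecI index_zero_vec)
  \<comment> \<open>The index \<open>p\<close> forces \<open>n - 1 > 0\<close>, so
    \<open>n - 2\<close> is strictly below the number of roots despite truncated
    subtraction.\<close>
  have "degree q \<le> n - 2" using p(1) by (intro degree_le) (auto simp: coeff_q)
  then have "q = 0"
    using root p(1) card_image[OF assms]
    by (intro poly_eqI_degree[of "z ` {1..n-1}"]) auto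
  with coeff_q[of p] p show False by simp
qed

context
  fixes n :: nat and z :: "nat \<Rightarrow> complex"
  assumes n: "n \<ge> 3" and inj: "inj_on z {1..n-1}"
begin

text \<open>Both sides have degree at most \<open>n-2\<close>, share the coefficient at
  \<open>n-2\<close>, and vanish at the \<open>n-2\<close> nodes other than \<open>z k\<close>;
  hence they coincide.\<close>

lemma cofactor_poly_eq_prod:
  assumes k: "k \<in> {1..n-1}"
  shows "cofactor_poly n z k = smult (A_cof n z (n-1) k) (\<Prod>i\<in>{1..n-1}-{k}. [:- z i, 1:])"
proof -
  have card: "card ({1..n-1} - {k}) = n - 2" using k by auto
  have cimg: "card (z ` ({1..n-1} - {k})) = n - 2"
    using card card_image[OF inj_on_subset[OF inj]] by (metis Diff_subset)
  show ?thesis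
  proof (rule poly_eqI_degree_lead_coeff)
    have "Suc (n - 2) = n - 1" using n by simp
    with coeff_prod_linear_card[of z "{1..n-1} - {k}"] n
    show "coeff (cofactor_poly n z k) (n-2)
      = coeff (smult (A_cof n z (n-1) k) (\<Prod>i\<in>{1..n-1}-{k}. [:- z i, 1:])) (n-2)"
      unfolding card by (simp add: coeff_cofactor_poly)
    show "n - 2 \<le> card (z ` ({1..n-1} - {k}))" using cimg by simp
    show "degree (cofactor_poly n z k) \<le> n - 2"
      by (rule degree_le) (auto simp: coeff_cofactor_poly)
    show "degree (smult (A_cof n z (n-1) k) (\<Prod>i\<in>{1..n-1}-{k}. [:- z i, 1:])) \<le> n - 2"
      using degree_prod_linear[of z "{1..n-1} - {k}"] card
      by (metis degree_smult_le)
    fix x assume "x \<in> z ` ({1..n-1} - {k})"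
    then obtain i where i: "i \<in> {1..n-1} - {k}" "x = z i" by blast
    then have "(\<Prod>i\<in>{1..n-1}-{k}. x - z i) = 0" by (intro prod_zero) auto
    moreover have "poly (cofactor_poly n z k) x = 0"
      using poly_cofactor_poly[OF k, of i z] i by simp
    ultimately show "poly (cofactor_poly n z k) x
      = poly (smult (A_cof n z (n-1) k) (\<Prod>i\<in>{1..n-1}-{k}. [:- z i, 1:])) x"
      by (simp add: poly_prod)
  qed
qed

lemma A_cof_penultimate:
  assumes k: "k \<in> {1..n-1}"
  shows "A_cof n z (n-2) k = - A_cof n z (n-1) k * (\<Sum>i\<in>{1..n-1}-{k}. z i)"
proof -
  \<comment> \<open>Cofactor row \<open>n-2\<close> is the coefficient at \<open>n-3\<close>, just
    below the leading one, so Vieta applies.\<close>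
  have "card ({1..n-1} - {k}) = Suc (n - 3)" using k n by auto
  then have "coeff (cofactor_poly n z k) (n-3)
    = - A_cof n z (n-1) k * (\<Sum>i\<in>{1..n-1}-{k}. z i)"
    unfolding cofactor_poly_eq_prod[OF k] by (simp add: coeff_prod_linear_subleading)
  moreover have "Suc (n - 3) = n - 2" "n - 3 < n - 1" using n by auto
  ultimately show ?thesis by (simp add: coeff_cofactor_poly)
qed

text \<open>At each node only one summand survives, with value the determinant; \<open>n-1\<close>
  nodes determine a polynomial of degree at most \<open>n-2\<close>.\<close>

lemma sum_cofactor_poly:
  "(\<Sum>k\<in>{1..n-1}. cofactor_poly n z k) = [:det (vandermonde_mat n z):]" (is "?L = _")
proof (rule poly_eqI_degree[of "z ` {1..n-1}"])
  have "degree ?L \<le> n - 2"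
    by (rule degree_le) (auto simp: coeff_sum coeff_cofactor_poly intro!: sum.neutral)
  then show "degree ?L < card (z ` {1..n-1})" using n card_image[OF inj] by simp
  show "degree [:det (vandermonde_mat n z):] < card (z ` {1..n-1})"
    using n card_image[OF inj] by simp
  fix x assume "x \<in> z ` {1..n-1}"
  then obtain i where i: "i \<in> {1..n-1}" "x = z i" by auto
  then have "poly ?L x = (\<Sum>k\<in>{1..n-1}. if i = k then det (vandermonde_mat n z) else 0)"
    by (simp only: poly_sum) (intro sum.cong, auto simp: poly_cofactor_poly)
  also have "\<dots> = det (vandermonde_mat n z)" using i by (subst sum.delta') auto
  finally show "poly ?L x = poly [:det (vandermonde_mat n z):] x" by simp
qed

lemma sum_A_cof_last: "(\<Sum>k\<in>{1..n-1}. A_cof n z (n-1) k) = 0"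
proof -
  \<comment> \<open>A constant has no coefficient at \<open>n-2\<close>, which is at least 1 since
    \<open>n \<ge> 3\<close>.\<close>
  have "coeff (\<Sum>k\<in>{1..n-1}. cofactor_poly n z k) (n-2) = 0"
    unfolding sum_cofactor_poly using n by (simp add: coeff_pCons split: nat.splits)
  moreover have "Suc (n - 2) = n - 1" "n - 2 < n - 1" using n by auto
  ultimately show ?thesis by (simp add: coeff_sum coeff_cofactor_poly)
qed

lemma A_cof_partial_fractions:
  assumes w: "w \<notin> poles n z"
  shows "(\<Sum>k\<in>{1..n-1}. A_cof n z (n-1) k / (w - z k))
    = det (vandermonde_mat n z) * (1 / (\<Prod>k\<in>{1..n-1}. w - z k))"
proof -
  have ne: "w - z k \<noteq> 0" if "k \<in> {1..n-1}" for k using w that by (auto simp: poles_def)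
  define W where "W = (\<Prod>k\<in>{1..n-1}. w - z k)"
  have "W \<noteq> 0" using ne by (simp add: W_def)
  have "poly (cofactor_poly n z k) w = A_cof n z (n-1) k / (w - z k) * W"
    if "k \<in> {1..n-1}" for k
  proof -
    have "W = (w - z k) * (\<Prod>i\<in>{1..n-1}-{k}. w - z i)"
      unfolding W_def using that by (intro prod.remove) auto
    then show ?thesis
      using ne[OF that] by (simp add: cofactor_poly_eq_prod[OF that] poly_prod)
  qed
  then have "(\<Sum>k\<in>{1..n-1}. A_cof n z (n-1) k / (w - z k)) * W
      = poly (\<Sum>k\<in>{1..n-1}. cofactor_poly n z k) w"
    by (simp add: poly_sum sum_distrib_right)
  also have "\<dots> = det (vandermonde_mat n z)" unfolding sum_cofactor_poly by simp
  finally show ?thesis using \<open>W \<noteq> 0\<close> by (simp add: W_def field_simps)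
qed


subsection \<open>Closed form of the functions\<close>

text \<open>The full sum of the nodes enters with opposite signs through
  \<open>A_cof n z (n-2) k\<close> and \<open>b_coef\<close>; it cancels and leaves
  \<open>z k - z r\<close>. The \<open>V3\<close> term corrects \<open>m/(n-1)\<close> to
  \<open>m/n\<close>, and its top entry is \<open>m/n\<close> as well.\<close>

lemma ell_index:
  assumes k: "k \<in> {1..n-1}" and r: "r < n"
  shows "ell n z k j $ r = A_cof n z (n-1) k *
    (m_coef n z j / of_nat n + (if r = 0 then 0 else a_coef n r j * (z k - z r)))"
proof -
  have S: "(\<Sum>i\<in>{1..n-1}-{l}. z i) = (\<Sum>i\<in>{1..n-1}. z i) - z l" if "l \<in> {1..n-1}" for l
    using that by (subst sum_diff1) auto
  define N where "N = (of_nat (n-1) :: complex)"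
  have N: "of_nat n = N + 1" "N \<noteq> 0" "N + 1 \<noteq> 0"
  proof -
    have "n = Suc (n - 1)" using n by simp
    then show "of_nat n = N + 1" unfolding N_def by (metis of_nat_Suc add.commute)
    then show "N + 1 \<noteq> 0" using n by (metis of_nat_eq_0_iff not_numeral_le_zero)
    show "N \<noteq> 0" using n by (auto simp: N_def)
  qed
  define M where "M = m_coef n z j"
  have avg: "M / N - M / ((N + 1) * N) = M / (N + 1)"
    using N(2,3) by (simp add: divide_simps) (simp add: algebra_simps)
  have base: "ell n z k j $ r = A_cof n z (n-2) k * G_pen n j $ r + A_cof n z (n-1) k * G_last n z j $ r"
    using r by (simp add: ell_def G_pen_def G_last_def V3_def)
  show ?thesis
  proof (cases "r = 0")
    case True
    have "G_last n z j $ 0 = M / (N + 1)" "G_pen n j $ 0 = 0"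
      using n N by (simp_all add: G_last_def G_pen_def V3_def M_def flip: N_def)
    with True show ?thesis unfolding base by (simp add: M_def N(1))
  next
    case False
    then have rr: "r \<in> {1..n-1}" using r by auto
    have "b_coef n z r j = a_coef n r j * ((\<Sum>i\<in>{1..n-1}. z i) - z r) + M / N"
      by (simp only: b_coef_def S[OF rr] N_def M_def)
    moreover have "G_last n z j $ r = b_coef n z r j - M / ((N + 1) * N)"
      using False r unfolding G_last_def V3_def N(1) N_def[symmetric] M_def[symmetric] by simp
    ultimately have G: "G_last n z j $ r
      = a_coef n r j * ((\<Sum>i\<in>{1..n-1}. z i) - z r) + (M / N - M / ((N + 1) * N))"
      by simp
    show ?thesis unfolding base A_cof_penultimate[OF k] S[OF k] G avg N(1)
      using False r by (simp add: G_pen_def algebra_simps flip: M_def)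
  qed
qed

lemma Y_fun_carrier: "Y_fun n z j w \<in> carrier_vec n"
  unfolding Y_fun_def
  by (rule finsum_vec_closed) (auto simp: ell_def G_pen_def G_last_def V3_def)

text \<open>Write \<open>z k - z r = (w - z r) - (w - z k)\<close>: the second part cancels the pole
  and leaves a multiple of the sum of the last-row cofactors, which is 0.\<close>

lemma Y_fun_index:
  assumes w: "w \<notin> poles n z" and r: "r < n"
  shows "Y_fun n z j w $ r = det (vandermonde_mat n z) * (1 / (\<Prod>k\<in>{1..n-1}. w - z k)) *
    (m_coef n z j / of_nat n + (if r = 0 then 0 else a_coef n r j * (w - z r)))"
proof -
  define c where "c = (if r = 0 then 0 else a_coef n r j)"
  define d where "d = m_coef n z j / of_nat n"
  have ne: "w - z k \<noteq> 0" if "k \<in> {1..n-1}" for k using w that by (auto simp: poles_def)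
  have "Y_fun n z j w $ r = (\<Sum>k\<in>{1..n-1}. ((1 / (w - z k)) \<cdot>\<^sub>v ell n z k j) $ r)"
    unfolding Y_fun_def using r
    by (intro index_finsum_vec) (auto simp: ell_def G_pen_def G_last_def V3_def)
  also have "\<dots> = (\<Sum>k\<in>{1..n-1}. A_cof n z (n-1) k / (w - z k) * (d + c * (w - z r))
      - c * A_cof n z (n-1) k)"
  proof (rule sum.cong[OF refl])
    fix k assume k: "k \<in> {1..n-1}"
    have "((1 / (w - z k)) \<cdot>\<^sub>v ell n z k j) $ r = (1 / (w - z k)) * ell n z k j $ r"
      using r by (simp add: ell_def G_pen_def G_last_def V3_def)
    also have "ell n z k j $ r = A_cof n z (n-1) k * (d + c * (z k - z r))"
      by (simp add: ell_index[OF k r] c_def d_def)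
    finally show "((1 / (w - z k)) \<cdot>\<^sub>v ell n z k j) $ r
      = A_cof n z (n-1) k / (w - z k) * (d + c * (w - z r)) - c * A_cof n z (n-1) k"
      using ne[OF k] by (simp add: divide_simps) (simp add: algebra_simps)
  qed
  also have "\<dots> = (\<Sum>k\<in>{1..n-1}. A_cof n z (n-1) k / (w - z k)) * (d + c * (w - z r))
      - c * (\<Sum>k\<in>{1..n-1}. A_cof n z (n-1) k)"
    by (simp only: sum_subtractf sum_distrib_right sum_distrib_left)
  finally show ?thesis
    unfolding A_cof_partial_fractions[OF w] sum_A_cof_last c_def d_def by simp
qed

section \<open>Rationality and the differential equation\<close>

lemma rational_Y_fun: "rational_vec_on n (- poles n z) (Y_fun n z j)"
  unfolding rational_vec_on_def
proof (intro conjI ballI allI impI)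
  fix r assume r: "r < n"
  define c where "c = (if r = 0 then 0 else a_coef n r j)"
  define q where "q = (\<Prod>k\<in>{1..n-1}. [:- z k, 1:])"
  define p where "p = smult (det (vandermonde_mat n z))
    ([:m_coef n z j / of_nat n:] + smult c [:- z r, 1:])"
  have q: "poly q w = (\<Prod>k\<in>{1..n-1}. w - z k)" for w by (simp add: q_def poly_prod)
  have p: "poly p w = det (vandermonde_mat n z) * (m_coef n z j / of_nat n + c * (w - z r))" for w
    by (simp add: p_def) (simp add: algebra_simps)
  have "q \<noteq> 0" by (simp add: q_def)
  moreover have "poly q w \<noteq> 0 \<and> Y_fun n z j w $ r = poly p w / poly q w" if "w \<in> - poles n z" for w
    using that r by (auto simp: q p poles_def Y_fun_index c_def)
  ultimately show "\<exists>p q. q \<noteq> 0 \<and>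
      (\<forall>w\<in>- poles n z. poly q w \<noteq> 0 \<and> Y_fun n z j w $ r = poly p w / poly q w)"
    by blast
qed (rule Y_fun_carrier)

lemma sum_a_coef:
  assumes "j \<in> {2..n-1}"
  shows "(\<Sum>k\<in>{1..n-1}. a_coef n k j) = 0"
proof -
  have "(\<Sum>k\<in>{1..n-1}. a_coef n k j)
    = (\<Sum>k\<in>{1..n-1}. (if k = j - 1 then 1 else 0) - (if k = n - 1 then 1 else 0))"
    using assms by (intro sum.cong) (auto simp: a_coef_def)
  also have "\<dots> = 0" unfolding sum_subtractf using assms by auto
  finally show ?thesis .
qed

lemma is_solution_Y_fun:
  assumes j: "j \<in> {2..n-1}"
  shows "is_solution n (-1) z (Y_fun n z j)"
  unfolding is_solution_def has_vec_derivative_def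
proof (intro ballI conjI allI impI)
  fix w assume "w \<in> - poles n z"
  then have w: "w \<notin> poles n z" by simp
  then have ne: "w - z k \<noteq> 0" if "k \<in> {1..n-1}" for k using that by (auto simp: poles_def)
  show "Y_fun n z j w \<in> carrier_vec n" by (rule Y_fun_carrier)
  have "system_mat n z w \<in> carrier_mat n n"
    unfolding system_mat_def
    by (rule index_finsum_mat(2)[of _ 0 _ 0]) (use n in \<open>auto simp: swap_mat_def\<close>)
  then show car: "- 1 \<cdot>\<^sub>v (system_mat n z w *\<^sub>v Y_fun n z j w) \<in> carrier_vec n"
    using mult_mat_vec_carrier[OF _ Y_fun_carrier] by simp
  fix r assume r: "r < n"
  define f where "f = (\<lambda>u. det (vandermonde_mat n z) * (1 / (\<Prod>k\<in>{1..n-1}. u - z k)))"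
  define T where "T = (\<Sum>k\<in>{1..n-1}. 1 / (w - z k))"
  define d where "d = m_coef n z j / of_nat n"
  define c where "c = (if r = 0 then 0 else a_coef n r j)"
  have Y: "Y_fun n z j u $ s = f u * (d + (if s = 0 then 0 else a_coef n s j * (u - z s)))"
    if "u \<notin> poles n z" "s < n" for u s
    using Y_fun_index[OF that] by (simp add: f_def d_def)
  \<comment> \<open>\<open>f\<close> is the scalar factor common to all entries, with logarithmic
    derivative \<open>- T\<close>.\<close>
  have "(f has_field_derivative - T * f w) (at w)"
    unfolding f_def T_def
    using DERIV_cmult[OF has_field_derivative_inverse_prod_linear[of "{1..n-1}" w z]] ne
    by (force simp: mult_ac)
  then have "((\<lambda>u. f u * (d + c * (u - z r))) has_field_derivative
      - T * f w * (d + c * (w - z r)) + c * f w) (at w)"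
    by (auto intro!: derivative_eq_intros)
  \<comment> \<open>The closed form holds only off the poles; openness of that set lets the
    derivative pass to \<open>Y_fun\<close>.\<close>
  moreover have "open (- poles n z)" by (simp add: poles_def finite_imp_closed open_Compl)
  ultimately have D: "((\<lambda>u. Y_fun n z j u $ r) has_field_derivative
      - T * f w * (d + c * (w - z r)) + c * f w) (at w)"
    by (rule has_field_derivative_transform_within_open) (use w r in \<open>auto simp: Y c_def\<close>)
  have "(\<Sum>k\<in>{1..n-1}. Y_fun n z j w $ (if r = 0 then k else if r = k then 0 else r) / (w - z k))
    = T * f w * (d + c * (w - z r)) - c * f w"
  proof (cases "r = 0")
    case True
    \<comment> \<open>In the top row each quotient leaves a pole-free rest
      \<open>f w * a_coef n k j\<close>; these rests sum to 0.\<close>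
    have "(\<Sum>k\<in>{1..n-1}. Y_fun n z j w $ k / (w - z k))
      = (\<Sum>k\<in>{1..n-1}. 1 / (w - z k) * (f w * d) + f w * a_coef n k j)"
    proof (rule sum.cong[OF refl])
      fix k assume k: "k \<in> {1..n-1}"
      then have "Y_fun n z j w $ k = f w * (d + a_coef n k j * (w - z k))"
        by (subst Y[OF w]) auto
      then show "Y_fun n z j w $ k / (w - z k) = 1 / (w - z k) * (f w * d) + f w * a_coef n k j"
        using ne[OF k] by (simp add: divide_simps) (simp add: algebra_simps)
    qed
    also have "\<dots> = T * (f w * d) + f w * (\<Sum>k\<in>{1..n-1}. a_coef n k j)"
      by (simp only: sum.distrib sum_distrib_right sum_distrib_left T_def)
    finally show ?thesis using True sum_a_coef[OF j] by (simp add: c_def)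
  next
    case False
    then have rr: "r \<in> {1..n-1}" using r by auto
    \<comment> \<open>For \<open>k = r\<close> the top entry \<open>f w * d\<close> replaces
      \<open>f w * (d + c * (w - z r))\<close>; dividing the difference by \<open>w - z r\<close>
      gives the correction \<open>c * f w\<close>.\<close>
    have "(\<Sum>k\<in>{1..n-1}. Y_fun n z j w $ (if r = 0 then k else if r = k then 0 else r) / (w - z k))
      = (\<Sum>k\<in>{1..n-1}. 1 / (w - z k) * (f w * (d + c * (w - z r))) - (if k = r then c * f w else 0))"
    proof (rule sum.cong[OF refl])
      fix k assume k: "k \<in> {1..n-1}"
      show "Y_fun n z j w $ (if r = 0 then k else if r = k then 0 else r) / (w - z k)
        = 1 / (w - z k) * (f w * (d + c * (w - z r))) - (if k = r then c * f w else 0)"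
      proof (cases "k = r")
        case True
        then show ?thesis using False ne[OF k] r
          by (simp add: Y[OF w] divide_simps) (simp add: algebra_simps)
      next
        case neq: False
        then show ?thesis using False r by (simp add: Y[OF w] c_def)
      qed
    qed
    also have "\<dots> = T * (f w * (d + c * (w - z r))) - (\<Sum>k\<in>{1..n-1}. if k = r then c * f w else 0)"
      by (simp only: sum_subtractf sum_distrib_right T_def)
    also have "(\<Sum>k\<in>{1..n-1}. if k = r then c * f w else 0) = c * f w"
      using rr by (subst sum.delta) auto
    finally show ?thesis by (simp add: mult.assoc)
  qed
  moreover have "(- 1 \<cdot>\<^sub>v (system_mat n z w *\<^sub>v Y_fun n z j w)) $ r
    = - ((system_mat n z w *\<^sub>v Y_fun n z j w) $ r)"
    using carrier_vecD[OF car] r by (subst index_smult_vec(1)) (simp_all del: index_mult_mat_vec)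
  ultimately have "(- 1 \<cdot>\<^sub>v (system_mat n z w *\<^sub>v Y_fun n z j w)) $ r
    = - T * f w * (d + c * (w - z r)) + c * f w"
    unfolding system_mat_mult_index[OF r Y_fun_carrier] by simp
  with D show "((\<lambda>u. Y_fun n z j u $ r) has_field_derivative
      (- 1 \<cdot>\<^sub>v (system_mat n z w *\<^sub>v Y_fun n z j w)) $ r) (at w)"
    by simp
qed

section \<open>Linear independence\<close>

lemma lin_indep_Y_fun: "lin_indep_on n (- poles n z) {2..n-1} (Y_fun n z)"
  unfolding lin_indep_on_def
proof (intro allI impI ballI)
  fix c j
  assume 0: "\<forall>w\<in>- poles n z. finsum_vec TYPE(complex) n (\<lambda>j. c j \<cdot>\<^sub>v Y_fun n z j w) {2..n-1} = 0\<^sub>v n"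
    and j: "j \<in> {2..n-1}"
  \<comment> \<open>A single point off the finitely many poles suffices: there the scalar factor
    \<open>F\<close> is nonzero and can be divided out.\<close>
  have "infinite (- poles n z)"
    by (simp add: poles_def Compl_eq_Diff_UNIV Diff_infinite_finite infinite_UNIV_char_0)
  then obtain w where w: "w \<notin> poles n z"
    by (metis Compl_iff finite.emptyI ex_in_conv)
  then have ne: "w - z k \<noteq> 0" if "k \<in> {1..n-1}" for k using that by (auto simp: poles_def)
  define F where "F = det (vandermonde_mat n z) * (1 / (\<Prod>k\<in>{1..n-1}. w - z k))"
  have F: "F \<noteq> 0" using det_vandermonde_nonzero[OF inj] ne by (simp add: F_def)
  have eq: "(\<Sum>i\<in>{2..n-1}. c i * (m_coef n z i / of_nat n
      + (if r = 0 then 0 else a_coef n r i * (w - z r)))) = 0" if r: "r < n" for r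
  proof -
    have "finsum_vec TYPE(complex) n (\<lambda>j. c j \<cdot>\<^sub>v Y_fun n z j w) {2..n-1} $ r
      = (\<Sum>i\<in>{2..n-1}. (c i \<cdot>\<^sub>v Y_fun n z i w) $ r)"
      using r Y_fun_carrier by (intro index_finsum_vec) auto
    also have "\<dots> = (\<Sum>i\<in>{2..n-1}. F * (c i * (m_coef n z i / of_nat n
      + (if r = 0 then 0 else a_coef n r i * (w - z r)))))"
    proof (rule sum.cong[OF refl])
      fix i
      have "(c i \<cdot>\<^sub>v Y_fun n z i w) $ r = c i * Y_fun n z i w $ r"
        using r carrier_vecD[OF Y_fun_carrier[of i w]] by simp
      then show "(c i \<cdot>\<^sub>v Y_fun n z i w) $ r = F * (c i * (m_coef n z i / of_nat n
          + (if r = 0 then 0 else a_coef n r i * (w - z r))))"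
        by (simp add: Y_fun_index[OF w r] F_def)
    qed
    also have "\<dots> = F * (\<Sum>i\<in>{2..n-1}. c i * (m_coef n z i / of_nat n
      + (if r = 0 then 0 else a_coef n r i * (w - z r))))"
      by (simp only: sum_distrib_left)
    finally show ?thesis using 0 w r F by simp
  qed
  \<comment> \<open>Subtracting row 0 from row \<open>j-1\<close> removes the \<open>m_coef\<close>
    terms. As \<open>j - 1 \<noteq> n - 1\<close>, the coefficient \<open>a_coef n (j-1) i\<close>
    is nonzero only for \<open>i = j\<close>, which isolates \<open>c j\<close>.\<close>
  have j': "j - 1 < n" "j - 1 \<noteq> 0" "j - 1 \<in> {1..n-1}" using j by auto
  have "(\<Sum>i\<in>{2..n-1}. c i * (m_coef n z i / of_nat n)) = 0"
    using eq[of 0] n by simp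
  moreover have "(\<Sum>i\<in>{2..n-1}. c i * (m_coef n z i / of_nat n + a_coef n (j-1) i * (w - z (j-1)))) = 0"
    using eq[OF j'(1)] j'(2) by simp
  ultimately have "(\<Sum>i\<in>{2..n-1}. c i * a_coef n (j-1) i * (w - z (j-1))) = 0"
    by (simp add: distrib_left sum.distrib mult.assoc)
  also have "(\<Sum>i\<in>{2..n-1}. c i * a_coef n (j-1) i * (w - z (j-1)))
      = (\<Sum>i\<in>{2..n-1}. if i = j then c j * (w - z (j-1)) else 0)"
    using j by (intro sum.cong) (auto simp: a_coef_def)
  also have "\<dots> = c j * (w - z (j-1))" using j by (subst sum.delta) auto
  finally show "c j = 0" using ne[OF j'(3)] by simp
qed

end

theorem proposition2p3:
  fixes n :: nat and z :: "nat \<Rightarrow> complex"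
  assumes "n \<ge> 3"
    and "inj_on z {1..n-1}"
  shows "(\<forall>j\<in>{2..n-1}. rational_vec_on n (- poles n z) (Y_fun n z j)
            \<and> is_solution n (-1) z (Y_fun n z j))
       \<and> lin_indep_on n (- poles n z) {2..n-1} (Y_fun n z)"
  using rational_Y_fun[OF assms] is_solution_Y_fun[OF assms] lin_indep_Y_fun[OF assms] by blast

end
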